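(* Let $\mathbb F$ be a field, $q\in\mathbb F$ nonzero with $q^4\ne1$, and $V$ a vector space over $\mathbb F$ of dimension $d+1$, $d\ge1$. Let $\Phi=(A;\{E_i\}_{i=0}^d;A^*;\{E_i^*\}_{i=0}^d)$ be a Leonard system on $V$ of $q$-Racah type with Huang data $(a,b,c,d)$. Assume $b=a$ and define $$\tau_i=(-1)^ia^{-i}q^{i(d-i)}\qquad(0\le i\le d).$$ Let $0\ne f\in\mathbb F$ and define $$W=f\sum_{i=0}^d\tau_iE_i,\qquad W^*=f\sum_{i=0}^d\tau_iE_i^*.$$ Assume that $W,W^*$ is a Boltzmann pair for $A,A^*$. Then $c\in\{a,a^{-1}\}$.
   Context: A Leonard pair on $V$ is an ordered pair of linear maps $A,A^*:V\to V$ such that there is a basis of $V$ for which $A$ is irreducible tridiagonal and $A^*$ diagonal, and a basis for which $A^*$ is irreducible tridiagonal and $A$ diagonal (a tridiagonal matrix is irreducible if all its subdiagonal and superdiagonal entries are nonzero). Each of $A,A^*$ is then diagonalizable with all eigenspaces of dimension one. The primitive idempotents of $A$ are the projections onto its eigenspaces; an ordering $\{E_i\}_{i=0}^d$ of them is standard if for $0\ne v_i\in E_iV$ the matrix representing $A^*$ in the basis $\{v_i\}$ is irreducible tridiagonal; similarly for $A^*$. A Leonard system is a sequence $(A;\{E_i\}_{i=0}^d;A^*;\{E_i^*\}_{i=0}^d)$ where $A,A^*$ is a Leonard pair and $\{E_i\}$, $\{E_i^*\}$ are standard orderings of the primitive idempotents of $A$, $A^*$. Let $\theta_i$ (resp.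 $\theta_i^*$) be the eigenvalue of $A$ (resp. $A^*$) for $E_i$ (resp. $E_i^*$). First split sequence $\{\varphi_i\}_{i=1}^d$ of $\Phi$: for $0\ne u\in E_0^*V$ the vectors $u_i=(A-\theta_0I)(A-\theta_1I)\cdots(A-\theta_{i-1}I)u$ $(0\le i\le d)$ form a basis of $V$, and $A^*u_0=\theta_0^*u_0$, $A^*u_i=\theta_i^*u_i+\varphi_iu_{i-1}$ $(1\le i\le d)$, with $\varphi_i\neq0$ independent of $u$. The second split sequence $\{\phi_i\}_{i=1}^d$ of $\Phi$ is the first split sequence of the Leonard system $(A;\{E_{d-i}\}_{i=0}^d;A^*;\{E_i^*\}_{i=0}^d)$. $\Phi$ has $q$-Racah type if there are nonzero $a,b\in\mathbb F$ with $\theta_i=aq^{2i-d}+a^{-1}q^{d-2i}$ and $\theta_i^*=bq^{2i-d}+b^{-1}q^{d-2i}$ for $0\le i\le d$. In that case there is a nonzero $c\in\mathbb F$, unique up to inverse, such that for $1\le i\le d$ $$\varphi_i=a^{-1}b^{-1}q^{d+1}(q^i-q^{-i})(q^{i-d-1}-q^{d-i+1})(q^{-i}-abcq^{i-d-1})(q^{-i}-abc^{-1}q^{i-d-1}),$$ $$\phi_i=ab^{-1}q^{d+1}(q^i-q^{-i})(q^{i-d-1}-q^{d-i+1})(q^{-i}-a^{-1}bcq^{i-d-1})(q^{-i}-a^{-1}bc^{-1}q^{i-d-1}),$$ and $(a,b,c,d)$ is called a Huang data of $\Phi$. A Boltzmann pair for $A,A^*$ is an ordered pair $W,W^*$ of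 invertible elements with $W$ in the subalgebra of $\mathrm{End}(V)$ generated by $A$, $W^*$ in the subalgebra generated by $A^*$, and $WA^*W^{-1}=(W^* )^{-1}AW^*$. *)

theory Defs
  imports Main HOL.Vector_Spaces
begin

(* Sequences indexed by 0..d are functions on nat of which only the values at
   arguments <= d matter; endomorphisms of V are linear functions on the
   underlying type. *)

context vector_space
begin

abbreviation endo :: "('b \<Rightarrow> 'b) \<Rightarrow> bool" where
  "endo X \<equiv> Vector_Spaces.linear scale scale X"

definition ordered_basis :: "nat \<Rightarrow> (nat \<Rightarrow> 'b) \<Rightarrow> bool" where
  "ordered_basis d v \<longleftrightarrow>
     inj_on v {..d} \<and> independent (v ` {..d}) \<and> span (v ` {..d}) = UNIV"

(* Column convention: X (v j) is the sum over i of (matrix_wrt d v X i j) *s v i. *)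
definition matrix_wrt :: "nat \<Rightarrow> (nat \<Rightarrow> 'b) \<Rightarrow> ('b \<Rightarrow> 'b) \<Rightarrow> nat \<Rightarrow> nat \<Rightarrow> 'a" where
  "matrix_wrt d v X i j = representation (v ` {..d}) (X (v j)) (v i)"

end

definition diagonal :: "nat \<Rightarrow> (nat \<Rightarrow> nat \<Rightarrow> 'a::zero) \<Rightarrow> bool" where
  "diagonal d M \<longleftrightarrow> (\<forall>i\<le>d. \<forall>j\<le>d. i \<noteq> j \<longrightarrow> M i j = 0)"

definition irreducible_tridiagonal :: "nat \<Rightarrow> (nat \<Rightarrow> nat \<Rightarrow> 'a::zero) \<Rightarrow> bool" where
  "irreducible_tridiagonal d M \<longleftrightarrow>
     (\<forall>i\<le>d. \<forall>j\<le>d. (Suc i < j \<or> Suc j < i) \<longrightarrow> M i j = 0) \<and>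
     (\<forall>i<d. M i (Suc i) \<noteq> 0 \<and> M (Suc i) i \<noteq> 0)"

context vector_space
begin

definition leonard_pair :: "('b \<Rightarrow> 'b) \<Rightarrow> ('b \<Rightarrow> 'b) \<Rightarrow> bool" where
  "leonard_pair A As \<longleftrightarrow> endo A \<and> endo As \<and>
     (\<exists>d v. ordered_basis d v \<and>
        irreducible_tridiagonal d (matrix_wrt d v A) \<and> diagonal d (matrix_wrt d v As)) \<and>
     (\<exists>d v. ordered_basis d v \<and>
        irreducible_tridiagonal d (matrix_wrt d v As) \<and> diagonal d (matrix_wrt d v A))"

definition eigenspace :: "('b \<Rightarrow> 'b) \<Rightarrow> 'a \<Rightarrow> 'b set" where
  "eigenspace A t = {v. A v = t *s v}"

(* The projection onto an eigenspace is taken along the other eigenspaces; for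
   diagonalizable A this determines E from A and t. *)
definition primitive_idempotents :: "('b \<Rightarrow> 'b) \<Rightarrow> ('b \<Rightarrow> 'b) set" where
  "primitive_idempotents A =
     {E. endo E \<and> (\<exists>t. eigenspace A t \<noteq> {0} \<and>
            (\<forall>v\<in>eigenspace A t. E v = v) \<and>
            (\<forall>s. s \<noteq> t \<longrightarrow> (\<forall>v\<in>eigenspace A s. E v = 0)))}"

definition eigenvalue_of :: "('b \<Rightarrow> 'b) \<Rightarrow> ('b \<Rightarrow> 'b) \<Rightarrow> 'a" where
  "eigenvalue_of A E = (THE t. \<forall>v. A (E v) = t *s E v)"

definition standard_ordering ::
  "nat \<Rightarrow> ('b \<Rightarrow> 'b) \<Rightarrow> ('b \<Rightarrow> 'b) \<Rightarrow> (nat \<Rightarrow> 'b \<Rightarrow> 'b) \<Rightarrow> bool" where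
  "standard_ordering d A As E \<longleftrightarrow>
     bij_betw E {..d} (primitive_idempotents A) \<and>
     (\<forall>v. (\<forall>i\<le>d. v i \<noteq> 0 \<and> v i \<in> range (E i)) \<longrightarrow>
        irreducible_tridiagonal d (matrix_wrt d v As))"

definition leonard_system ::
  "nat \<Rightarrow> ('b \<Rightarrow> 'b) \<Rightarrow> (nat \<Rightarrow> 'b \<Rightarrow> 'b) \<Rightarrow> ('b \<Rightarrow> 'b) \<Rightarrow> (nat \<Rightarrow> 'b \<Rightarrow> 'b) \<Rightarrow> bool" where
  "leonard_system d A E As Es \<longleftrightarrow>
     leonard_pair A As \<and> standard_ordering d A As E \<and> standard_ordering d As A Es"

(* The factors A - th 0, A - th 1, ... commute, so their order is immaterial. *)
primrec split_vector :: "('b \<Rightarrow> 'b) \<Rightarrow> (nat \<Rightarrow> 'a) \<Rightarrow> 'b \<Rightarrow> nat \<Rightarrow> 'b" where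
  "split_vector A th u 0 = u"
| "split_vector A th u (Suc i) = A (split_vector A th u i) - th i *s split_vector A th u i"

definition first_split_sequence ::
  "nat \<Rightarrow> ('b \<Rightarrow> 'b) \<Rightarrow> (nat \<Rightarrow> 'b \<Rightarrow> 'b) \<Rightarrow> ('b \<Rightarrow> 'b) \<Rightarrow> (nat \<Rightarrow> 'b \<Rightarrow> 'b) \<Rightarrow> (nat \<Rightarrow> 'a) \<Rightarrow> bool"
where
  "first_split_sequence d A E As Es ph \<longleftrightarrow>
     (\<forall>i\<in>{1..d}. ph i \<noteq> 0) \<and>
     (\<forall>u. u \<noteq> 0 \<and> u \<in> range (Es 0) \<longrightarrow>
        (let w = split_vector A (\<lambda>i. eigenvalue_of A (E i)) u in
           ordered_basis d w \<and>
           As (w 0) = eigenvalue_of As (Es 0) *s w 0 \<and>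
           (\<forall>i\<in>{1..d}. As (w i) = eigenvalue_of As (Es i) *s w i + ph i *s w (i - 1))))"

definition second_split_sequence ::
  "nat \<Rightarrow> ('b \<Rightarrow> 'b) \<Rightarrow> (nat \<Rightarrow> 'b \<Rightarrow> 'b) \<Rightarrow> ('b \<Rightarrow> 'b) \<Rightarrow> (nat \<Rightarrow> 'b \<Rightarrow> 'b) \<Rightarrow> (nat \<Rightarrow> 'a) \<Rightarrow> bool"
where
  "second_split_sequence d A E As Es ph \<longleftrightarrow>
     first_split_sequence d A (\<lambda>i. E (d - i)) As Es ph"

definition q_racah_eigenvalues ::
  "'a \<Rightarrow> nat \<Rightarrow> ('b \<Rightarrow> 'b) \<Rightarrow> (nat \<Rightarrow> 'b \<Rightarrow> 'b) \<Rightarrow> ('b \<Rightarrow> 'b) \<Rightarrow> (nat \<Rightarrow> 'b \<Rightarrow> 'b) \<Rightarrow> 'a \<Rightarrow> 'a \<Rightarrow> bool"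
where
  "q_racah_eigenvalues q d A E As Es a b \<longleftrightarrow>
     a \<noteq> 0 \<and> b \<noteq> 0 \<and>
     (\<forall>i\<le>d.
        eigenvalue_of A (E i) =
          a * q powi (2 * int i - int d) + inverse a * q powi (int d - 2 * int i) \<and>
        eigenvalue_of As (Es i) =
          b * q powi (2 * int i - int d) + inverse b * q powi (int d - 2 * int i))"

definition q_racah_type ::
  "'a \<Rightarrow> nat \<Rightarrow> ('b \<Rightarrow> 'b) \<Rightarrow> (nat \<Rightarrow> 'b \<Rightarrow> 'b) \<Rightarrow> ('b \<Rightarrow> 'b) \<Rightarrow> (nat \<Rightarrow> 'b \<Rightarrow> 'b) \<Rightarrow> bool"
where
  "q_racah_type q d A E As Es \<longleftrightarrow> (\<exists>a b. q_racah_eigenvalues q d A E As Es a b)"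

definition huang_data ::
  "'a \<Rightarrow> nat \<Rightarrow> ('b \<Rightarrow> 'b) \<Rightarrow> (nat \<Rightarrow> 'b \<Rightarrow> 'b) \<Rightarrow> ('b \<Rightarrow> 'b) \<Rightarrow> (nat \<Rightarrow> 'b \<Rightarrow> 'b) \<Rightarrow>
   'a \<Rightarrow> 'a \<Rightarrow> 'a \<Rightarrow> bool"
where
  "huang_data q d A E As Es a b c \<longleftrightarrow>
     q_racah_eigenvalues q d A E As Es a b \<and> c \<noteq> 0 \<and>
     first_split_sequence d A E As Es (\<lambda>i.
       inverse a * inverse b * q ^ (d + 1)
       * (q powi int i - q powi (- int i))
       * (q powi (int i - int d - 1) - q powi (int d - int i + 1))
       * (q powi (- int i) - a * b * c * q powi (int i - int d - 1))
       * (q powi (- int i) - a * b * inverse c * q powi (int i - int d - 1))) \<and>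
     second_split_sequence d A E As Es (\<lambda>i.
       a * inverse b * q ^ (d + 1)
       * (q powi int i - q powi (- int i))
       * (q powi (int i - int d - 1) - q powi (int d - int i + 1))
       * (q powi (- int i) - inverse a * b * c * q powi (int i - int d - 1))
       * (q powi (- int i) - inverse a * b * inverse c * q powi (int i - int d - 1)))"

definition subalgebra :: "('b \<Rightarrow> 'b) set \<Rightarrow> bool" where
  "subalgebra S \<longleftrightarrow>
     S \<subseteq> Collect endo \<and> id \<in> S \<and>
     (\<forall>X\<in>S. \<forall>Y\<in>S. (\<lambda>v. X v + Y v) \<in> S \<and> X \<circ> Y \<in> S) \<and>
     (\<forall>X\<in>S. \<forall>k. (\<lambda>v. k *s X v) \<in> S)"

definition boltzmann_pair ::
  "('b \<Rightarrow> 'b) \<Rightarrow> ('b \<Rightarrow> 'b) \<Rightarrow> ('b \<Rightarrow> 'b) \<Rightarrow> ('b \<Rightarrow> 'b) \<Rightarrow> bool" where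
  "boltzmann_pair A As W Ws \<longleftrightarrow>
     W \<in> subalgebra hull {A} \<and> bij W \<and>
     Ws \<in> subalgebra hull {As} \<and> bij Ws \<and>
     W \<circ> As \<circ> inv W = inv Ws \<circ> A \<circ> Ws"

end

end

theory Submission
  imports Defs
begin

text \<open>
Put \<open>M = Ws W\<close>. The Boltzmann condition says \<open>M As = A M\<close>. For nonzero \<open>u\<close> in the range of \<open>Es 0\<close>
consider the basis \<open>w i = (A - \<theta> d) \<dots> (A - \<theta> (d - i + 1)) u\<close> that defines the second split
sequence. With respect to it \<open>A\<close> is lower bidiagonal with diagonal \<open>\<theta> d, \<dots>, \<theta> 0\<close> and \<open>As\<close> is upper
bidiagonal with diagonal \<open>\<theta> 0, \<dots>, \<theta> d\<close> (the eigenvalues of \<open>As\<close> agree with those of \<open>A\<close> because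
\<open>b = a\<close>). Hence \<open>W\<close> is lower and \<open>Ws\<close> upper triangular. The last column of \<open>W\<close> and the last row of
\<open>Ws\<close> are zero off the diagonal, so the last diagonal entry of the equation \<open>M As = A M\<close> involves only
the two-by-two corner of each matrix. It reads

  \<open>\<tau> 0 \<tau> d (\<theta> d - \<theta> 0) = \<phi> d (\<tau> 0 [d, d - 1] - \<tau> d [0, 1])\<close>,

where \<open>[i, j] = (\<tau> i - \<tau> j) / (\<theta> i - \<theta> j)\<close>; this is \<open>second_split_corner\<close>, obtained from the matrix-free
\<open>corner_identity\<close>. The weights are nonzero and the eigenvalues
distinct, so the equation determines \<open>\<phi> d\<close>. In the q-Racah
parametrization \<open>\<phi> d\<close> is an affine function of \<open>c + 1 / c\<close> with nonzero slope, and the solution turns out to be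
\<open>c + 1 / c = a + 1 / a\<close> (\<open>huang_parameter_of_corner\<close>), that is, \<open>c\<close> is \<open>a\<close> or its inverse.

The reversal of the \<open>E i\<close> matters. In the basis for the first split sequence both triangular matrices
have the same diagonal, and the corresponding corner equation holds identically.
\<close>

context vector_space
begin

section \<open>Complete systems of eigenprojections\<close>

text \<open>
The primitive idempotents of a diagonalizable map, packaged with their distinct eigenvalues. That \<open>E i\<close> is the projection along the other eigenspaces is expressed on
eigenvectors only; together with the resolution of the identity this determines \<open>E i\<close>.
\<close>

definition eigenprojections ::
  "nat \<Rightarrow> ('b \<Rightarrow> 'b) \<Rightarrow> (nat \<Rightarrow> 'b \<Rightarrow> 'b) \<Rightarrow> (nat \<Rightarrow> 'a) \<Rightarrow> bool"
where
  "eigenprojections d A E th \<longleftrightarrow>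
     inj_on th {..d} \<and>
     (\<forall>i\<le>d. endo (E i) \<and> (\<exists>v. v \<noteq> 0 \<and> E i v = v) \<and> (\<forall>v. A (E i v) = th i *s E i v)) \<and>
     (\<forall>i\<le>d. \<forall>j\<le>d. \<forall>v. A v = th j *s v \<longrightarrow> E i v = (if i = j then v else 0)) \<and>
     (\<forall>v. (\<Sum>i\<le>d. E i v) = v)"

lemma diagonal_basis_eigenvectors:
  assumes "ordered_basis d v" "diagonal d (matrix_wrt d v A)" "j \<le> d"
  shows "A (v j) = matrix_wrt d v A j j *s v j"
proof -
  let ?B = "v ` {..d}"
  have B: "independent ?B" "span ?B = UNIV" "inj_on v {..d}"
    using assms(1) by (auto simp: ordered_basis_def)
  have "A (v j) = (\<Sum>b\<in>?B. representation ?B (A (v j)) b *s b)"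
    by (rule sum_representation_eq[symmetric]) (use B in auto)
  also have "\<dots> = (\<Sum>i\<le>d. matrix_wrt d v A i j *s v i)"
    using B(3) by (simp add: sum.reindex matrix_wrt_def)
  also have "\<dots> = (\<Sum>i\<le>d. if i = j then matrix_wrt d v A j j *s v j else 0)"
    using assms(2,3) by (intro sum.cong) (auto simp: diagonal_def)
  finally show ?thesis using assms(3) by simp
qed

lemma endo_eq_on_eigenvectors:
  assumes "span {v. \<exists>t. A v = t *s v} = UNIV" "endo X" "endo Y"
    and "\<And>v t. A v = t *s v \<Longrightarrow> X v = Y v"
  shows "X v = Y v"
proof -
  interpret vector_space_pair scale scale ..
  show ?thesis
    by (rule linear_eq_on[OF assms(2,3)]) (use assms(1,4) in auto)
qed

text \<open>
Since the eigenvectors of \<open>A\<close> span, a primitive idempotent is determined by its eigenvalue, so the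
\<open>d + 1\<close> idempotents in the list have distinct eigenvalues. One eigenvector for each of them gives
\<open>d + 1\<close> independent vectors in a space of dimension \<open>d + 1\<close>, hence a basis, and on this basis the sum
of the idempotents is visibly the identity.
\<close>

lemma eigenprojections_of_standard_ordering:
  assumes A: "endo A" and B: "ordered_basis n b" "diagonal n (matrix_wrt n b A)"
    and dim: "dim UNIV = d + 1"
    and E: "bij_betw E {..d} (primitive_idempotents A)"
  shows "eigenprojections d A E (\<lambda>i. eigenvalue_of A (E i))"
proof -
  interpret A: Vector_Spaces.linear scale scale A by fact
  let ?V = "{v. \<exists>t. A v = t *s v}"
  have "b ` {..n} \<subseteq> ?V"
    using diagonal_basis_eigenvectors[OF B] by blast
  then have sp: "span ?V = UNIV"
    using B(1) span_mono unfolding ordered_basis_def by blast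
  interpret fin: finite_dimensional_vector_space scale "b ` {..n}"
    using B(1) by unfold_locales (auto simp: ordered_basis_def)
  have prim: "E i \<in> primitive_idempotents A" if "i \<le> d" for i
    using bij_betwE[OF E] that by simp
  then have EE: "endo (E i)" if "i \<le> d" for i
    using that by (simp add: primitive_idempotents_def)
  have "\<forall>i. \<exists>t. i \<le> d \<longrightarrow> eigenspace A t \<noteq> {0} \<and> (\<forall>v\<in>eigenspace A t. E i v = v) \<and>
            (\<forall>s. s \<noteq> t \<longrightarrow> (\<forall>v\<in>eigenspace A s. E i v = 0))"
    using prim by (simp add: primitive_idempotents_def)
  from choice[OF this] obtain th where
    "\<forall>i. i \<le> d \<longrightarrow> eigenspace A (th i) \<noteq> {0} \<and> (\<forall>v\<in>eigenspace A (th i). E i v = v) \<and>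
            (\<forall>s. s \<noteq> th i \<longrightarrow> (\<forall>v\<in>eigenspace A s. E i v = 0))"
    by blast
  then have th: "\<And>i. i \<le> d \<Longrightarrow> eigenspace A (th i) \<noteq> {0}"
      "\<And>i v. i \<le> d \<Longrightarrow> A v = th i *s v \<Longrightarrow> E i v = v"
      "\<And>i v s. i \<le> d \<Longrightarrow> A v = s *s v \<Longrightarrow> s \<noteq> th i \<Longrightarrow> E i v = 0"
    by (auto simp: eigenspace_def)
  have nonzero: "\<exists>v. v \<noteq> 0 \<and> A v = th i *s v \<and> E i v = v" if "i \<le> d" for i
  proof -
    have "0 \<in> eigenspace A (th i)" by (simp add: eigenspace_def A.zero)
    with th(1)[OF that] obtain v where "v \<noteq> 0" "v \<in> eigenspace A (th i)" by blast
    then show ?thesis using th(2)[OF that] by (auto simp: eigenspace_def)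
  qed
  have AE: "A (E i v) = th i *s E i v" if i: "i \<le> d" for i v
  proof (rule endo_eq_on_eigenvectors[OF sp, of "\<lambda>v. A (E i v)" "\<lambda>v. th i *s E i v"])
    show "endo (\<lambda>v. A (E i v))"
      using Vector_Spaces.linear_compose[OF EE[OF i] A] by (simp add: comp_def)
    show "endo (\<lambda>v. th i *s E i v)"
      using EE[OF i] by (simp add: linear_iff algebra_simps)
    fix v t assume "A v = t *s v"
    then show "A (E i v) = th i *s E i v"
      using th(2)[OF i, of v] th(3)[OF i, of v t] by (cases "t = th i") (auto simp: A.zero)
  qed
  have ev: "eigenvalue_of A (E i) = th i" if "i \<le> d" for i
    unfolding eigenvalue_of_def
  proof (rule the_equality)
    show "\<forall>v. A (E i v) = th i *s E i v" using AE[OF that] by simp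
    fix t assume "\<forall>v. A (E i v) = t *s E i v"
    with nonzero[OF that] show "t = th i" by (metis scale_cancel_right)
  qed
  have inj: "inj_on th {..d}"
  proof (rule inj_onI)
    fix i j assume ij: "i \<in> {..d}" "j \<in> {..d}" "th i = th j"
    have "E i = E j"
    proof
      fix v show "E i v = E j v"
      proof (rule endo_eq_on_eigenvectors[OF sp, of "E i" "E j"])
        fix v t assume "A v = t *s v"
        then show "E i v = E j v"
          using ij th(2)[of i v] th(3)[of i v t] th(2)[of j v] th(3)[of j v t]
          by (cases "t = th i") auto
      qed (use ij EE in auto)
    qed
    with ij E show "i = j" by (meson bij_betw_imp_inj_on inj_onD)
  qed
  have delta: "E i v = (if i = j then v else 0)" if "i \<le> d" "j \<le> d" "A v = th j *s v" for i j v
  proof (cases "i = j")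
    case True
    then show ?thesis using th(2)[OF that(1)] that by simp
  next
    case False
    then have "th j \<noteq> th i" using that inj by (auto dest: inj_onD)
    then show ?thesis using th(3)[OF that(1,3)] False by simp
  qed
  obtain x where x: "\<And>i. i \<le> d \<Longrightarrow> x i \<noteq> 0 \<and> A (x i) = th i *s x i"
    using nonzero by metis
  have Ex: "E i (x j) = (if i = j then x j else 0)" if "i \<le> d" "j \<le> d" for i j
    using delta[OF that] x that by blast
  have injx: "inj_on x {..d}"
    by (rule inj_onI) (metis Ex x atMost_iff)
  have ind: "independent (x ` {..d})"
  proof (rule independent_if_scalars_zero)
    fix g y assume 0: "(\<Sum>y\<in>x ` {..d}. g y *s y) = 0" and "y \<in> x ` {..d}"
    then obtain k where k: "k \<le> d" "y = x k" by auto
    interpret Ek: Vector_Spaces.linear scale scale "E k" using EE[OF k(1)] .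
    have "0 = E k (\<Sum>i\<le>d. g (x i) *s x i)"
      using 0 injx by (simp add: sum.reindex Ek.zero)
    also have "\<dots> = (\<Sum>i\<le>d. if i = k then g y *s y else 0)"
      unfolding Ek.sum Ek.scale by (rule sum.cong) (use k Ex in auto)
    finally have "g y *s y = 0" using k by simp
    then show "g y = 0" using k x by auto
  qed simp
  have spx: "span (x ` {..d}) = UNIV"
    using fin.card_ge_dim_independent[of "x ` {..d}" UNIV] ind dim injx
    by (auto simp: card_image)
  have sumE: "(\<Sum>i\<le>d. E i v) = v" for v
  proof -
    interpret vector_space_pair scale scale ..
    show ?thesis
    proof (rule linear_eq_on[OF _ linear_ident])
      show "endo (\<lambda>v. \<Sum>i\<le>d. E i v)"
        by (rule linear_compose_sum) (use EE in auto)
      show "v \<in> span (x ` {..d})" using spx by simp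
      fix y assume "y \<in> x ` {..d}"
      then obtain k where k: "k \<le> d" "y = x k" by auto
      have "(\<Sum>i\<le>d. E i y) = (\<Sum>i\<le>d. if i = k then y else 0)"
        by (rule sum.cong) (use k Ex in auto)
      then show "(\<Sum>i\<le>d. E i y) = y" using k by simp
    qed
  qed
  have "\<exists>v. v \<noteq> 0 \<and> E i v = v" if "i \<le> d" for i
    using nonzero[OF that] by blast
  then show ?thesis
    unfolding eigenprojections_def using ev inj EE AE delta sumE
    by (auto simp: inj_on_def)
qed

section \<open>Linear functionals and coordinates\<close>

lemma functional_rules:
  assumes "Vector_Spaces.linear scale (*) g"
  shows "g (x + y) = g x + g y" "g (x - y) = g x - g y" "g (t *s x) = t * g x"
    "g (sum h I) = (\<Sum>i\<in>I. g (h i))"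
proof -
  interpret g: Vector_Spaces.linear scale "(*)" g by fact
  show "g (x + y) = g x + g y" "g (x - y) = g x - g y" "g (t *s x) = t * g x"
    "g (sum h I) = (\<Sum>i\<in>I. g (h i))"
    by (fact g.add g.diff g.scale g.sum)+
qed

lemma functional_combination:
  assumes "Vector_Spaces.linear scale (*) g" "Vector_Spaces.linear scale (*) h"
  shows "Vector_Spaces.linear scale (*) (\<lambda>v. s * g v + t * h v)"
proof -
  interpret vector_space_pair scale "(*)"
    using assms(1) by (simp add: linear_iff vector_space_pair_def)
  show ?thesis
    by (intro linear_compose_add linear_compose_scale_right assms)
qed

lemma functional_compose:
  assumes "endo X" "Vector_Spaces.linear scale (*) g"
  shows "Vector_Spaces.linear scale (*) (\<lambda>v. g (X v))"
  using Vector_Spaces.linear_compose[OF assms] by (simp add: comp_def)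

lemma ordered_basis_coordinate:
  assumes "ordered_basis d w"
  shows "Vector_Spaces.linear scale (*) (\<lambda>v. representation (w ` {..d}) v b)"
    and "i \<le> d \<Longrightarrow> j \<le> d \<Longrightarrow>
      representation (w ` {..d}) (w i) (w j) = (if i = j then 1 else 0)"
proof -
  show "Vector_Spaces.linear scale (*) (\<lambda>v. representation (w ` {..d}) v b)"
    using assms by (intro linear_representation) (auto simp: ordered_basis_def)
  assume "i \<le> d" "j \<le> d"
  then show "representation (w ` {..d}) (w i) (w j) = (if i = j then 1 else 0)"
    using assms
    by (subst representation_basis) (auto simp: ordered_basis_def dest: inj_onD)
qed

lemma functional_eq_on_ordered_basis:
  assumes w: "ordered_basis d w"
    and "Vector_Spaces.linear scale (*) g" "Vector_Spaces.linear scale (*) h"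
    and "\<And>i. i \<le> d \<Longrightarrow> g (w i) = h (w i)"
  shows "g v = h v"
proof -
  interpret vector_space_pair scale "(*)"
    using assms(2) by (simp add: linear_iff vector_space_pair_def)
  show ?thesis
    by (rule linear_eq_on[OF assms(2,3), of v "w ` {..d}"])
      (use w assms(4) in \<open>auto simp: ordered_basis_def\<close>)
qed

section \<open>Weighted sums of eigenprojections\<close>

lemma weighted_sum_linear:
  assumes "\<And>i. i \<le> d \<Longrightarrow> endo (E i)"
  shows "endo (\<lambda>v. f *s (\<Sum>i\<le>d. \<tau> i *s E i v))"
proof -
  interpret vector_space_pair scale scale ..
  show ?thesis
    by (intro linear_compose_scale_right linear_compose_sum ballI) (use assms in auto)
qed

lemma weighted_sum_eigenvector:
  assumes P: "eigenprojections d A E th" and j: "j \<le> d" and v: "A v = th j *s v"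
  shows "f *s (\<Sum>i\<le>d. \<tau> i *s E i v) = (f * \<tau> j) *s v"
proof -
  have "(\<Sum>i\<le>d. \<tau> i *s E i v) = (\<Sum>i\<le>d. if i = j then \<tau> j *s v else 0)"
    using P j v unfolding eigenprojections_def by (intro sum.cong) auto
  then show ?thesis using j by simp
qed

text \<open>
The transposed form of the preceding lemma: a left eigenvector \<open>g\<close> of \<open>A\<close> vanishes on every
eigenspace but the one belonging to its eigenvalue.
\<close>

lemma weighted_sum_eigenfunctional:
  assumes P: "eigenprojections d A E th" and j: "j \<le> d"
    and g: "Vector_Spaces.linear scale (*) g" and gA: "\<And>v. g (A v) = th j * g v"
  shows "g (f *s (\<Sum>i\<le>d. \<tau> i *s E i v)) = (f * \<tau> j) * g v"
proof -
  note g = functional_rules[OF g]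
  have gE: "g (E i v) = 0" if "i \<le> d" "i \<noteq> j" for i
  proof -
    have "th i * g (E i v) = th j * g (E i v)"
      using P that(1) gA[of "E i v"] by (simp add: eigenprojections_def g)
    moreover have "th i \<noteq> th j"
      using P that j unfolding eigenprojections_def by (auto dest: inj_onD)
    ultimately show ?thesis by simp
  qed
  have "g v = g (\<Sum>i\<le>d. E i v)" using P by (simp add: eigenprojections_def)
  also have "\<dots> = (\<Sum>i\<le>d. if i = j then g (E j v) else 0)"
    unfolding g using gE by (intro sum.cong) auto
  finally have gEj: "g (E j v) = g v" using j by simp
  have "g (\<Sum>i\<le>d. \<tau> i *s E i v) = (\<Sum>i\<le>d. if i = j then \<tau> j * g v else 0)"
    unfolding g using gE gEj by (intro sum.cong) auto
  then show ?thesis using j by (simp add: g mult.assoc)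
qed

section \<open>The corner entry of the intertwining relation\<close>

text \<open>
Here \<open>x, y\<close> are the last two vectors of a basis in which \<open>A\<close> is lower and \<open>As\<close> upper bidiagonal, and
\<open>\<alpha>, \<beta>\<close> are the corresponding coordinate functionals. The identity is the equation
\<open>\<beta> (Ws (W (As y))) = \<beta> (A (Ws (W y)))\<close>. It stays inside a two-by-two corner, because \<open>y\<close> is an
eigenvector of \<open>A\<close>, hence of \<open>W\<close>, and \<open>\<beta>\<close> is a left eigenvector of \<open>As\<close>, hence of \<open>Ws\<close>. The
only other entries that occur, \<open>\<beta> (W x)\<close> and \<open>\<alpha> (Ws y)\<close>, are divided differences: \<open>x\<close> minus a
multiple of \<open>y\<close> is again an eigenvector of \<open>A\<close>, and \<open>\<alpha>\<close> minus a multiple of \<open>\<beta>\<close> is again a left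
eigenvector of \<open>As\<close>.
\<close>

lemma corner_identity:
  assumes lin: "endo A" "endo W" "endo Ws"
    and fun_lin: "Vector_Spaces.linear scale (*) \<alpha>" "Vector_Spaces.linear scale (*) \<beta>"
    and inter: "\<And>v. Ws (W (As v)) = A (Ws (W v))"
    and W: "\<And>v. A v = th0 *s v \<Longrightarrow> W v = t0 *s v"
           "\<And>v. A v = th1 *s v \<Longrightarrow> W v = t1 *s v"
    and Ws: "\<And>g. Vector_Spaces.linear scale (*) g \<Longrightarrow> (\<And>v. g (As v) = thd * g v)
              \<Longrightarrow> (\<And>v. g (Ws v) = td * g v)"
            "\<And>g. Vector_Spaces.linear scale (*) g \<Longrightarrow> (\<And>v. g (As v) = thm * g v)
              \<Longrightarrow> (\<And>v. g (Ws v) = tm * g v)"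
    and A: "A x = th1 *s x + y" "A y = th0 *s y" "\<And>v. \<beta> (A v) = th0 * \<beta> v + \<alpha> v"
    and As: "As y = thd *s y + phi *s x"
       "\<And>v. \<beta> (As v) = thd * \<beta> v" "\<And>v. \<alpha> (As v) = thm * \<alpha> v + phi * \<beta> v"
    and dual: "\<alpha> y = 0" "\<beta> y = 1" "\<beta> x = 0"
    and ne: "th0 \<noteq> th1" "thd \<noteq> thm"
  shows "t0 * td * (thd - th0)
       = phi * (t0 * ((td - tm) / (thd - thm)) - td * ((t0 - t1) / (th0 - th1)))"
proof -
  interpret A: Vector_Spaces.linear scale scale A by fact
  interpret W: Vector_Spaces.linear scale scale W by fact
  interpret Ws: Vector_Spaces.linear scale scale Ws by fact
  note al = functional_rules[OF fun_lin(1)] and be = functional_rules[OF fun_lin(2)]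
  \<comment> \<open>The multiples that turn \<open>x\<close> and \<open>\<alpha>\<close> into an eigenvector and a left eigenvector.\<close>
  define k where "k = 1 / (th0 - th1)"
  define l where "l = phi / (thd - thm)"
  have k: "k * (th0 - th1) = 1" and l: "l * (thd - thm) = phi"
    using ne by (simp_all add: k_def l_def)
  have k': "1 - k * th0 = - (th1 * k)" using k by (simp add: algebra_simps)
  have "A (x - k *s y) = th1 *s x + (1 - k * th0) *s y"
    by (simp add: A.diff A.scale A algebra_simps)
  also have "\<dots> = th1 *s (x - k *s y)"
    unfolding k' by (simp add: algebra_simps)
  finally have "W (x - k *s y) = t1 *s (x - k *s y)" by (rule W)
  moreover have Wy: "W y = t0 *s y" using A(2) by (rule W)
  ultimately have Wx: "W x = t1 *s (x - k *s y) + (k * t0) *s y"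
    by (simp add: W.diff W.scale algebra_simps)
  have \<beta>Wx: "\<beta> (W x) = k * (t0 - t1)"
    by (simp add: Wx be dual algebra_simps)
  have \<beta>Ws: "\<beta> (Ws v) = td * \<beta> v" for v
    by (rule Ws(1)[of \<beta>, OF fun_lin(2) As(2)])
  have lg: "Vector_Spaces.linear scale (*) (\<lambda>v. \<alpha> v - l * \<beta> v)"
    using functional_combination[OF fun_lin, of 1 "- l"] by simp
  have "\<alpha> (Ws y) - l * \<beta> (Ws y) = tm * (\<alpha> y - l * \<beta> y)"
  proof (rule Ws(2)[of "\<lambda>v. \<alpha> v - l * \<beta> v", OF lg])
    fix v
    have "\<alpha> (As v) - l * \<beta> (As v) = thm * \<alpha> v + (phi - l * thd) * \<beta> v"
      by (simp add: As algebra_simps)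
    also have "phi - l * thd = - (thm * l)"
      unfolding l[symmetric] by (simp add: algebra_simps)
    finally show "\<alpha> (As v) - l * \<beta> (As v) = thm * (\<alpha> v - l * \<beta> v)"
      by (simp add: algebra_simps)
  qed
  then have \<alpha>Wsy: "\<alpha> (Ws y) = l * (td - tm)"
    by (simp add: \<beta>Ws dual algebra_simps)
  have "\<beta> (Ws (W (As y))) = td * (thd * t0 + phi * (k * (t0 - t1)))"
    by (simp add: \<beta>Ws As(1) W.add W.scale Wy be \<beta>Wx dual)
  moreover have "\<beta> (A (Ws (W y))) = t0 * (th0 * td + l * (td - tm))"
    by (simp add: A(3) Wy Ws.scale be al \<beta>Ws \<alpha>Wsy dual algebra_simps)
  ultimately have "td * (thd * t0 + phi * (k * (t0 - t1))) = t0 * (th0 * td + l * (td - tm))"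
    by (simp only: inter)
  then show ?thesis
    by (simp add: k_def l_def algebra_simps)
qed

text \<open>
The purpose of this expansion is that the split vectors end: once the parameters \<open>\<eta> j\<close> have run
through all eigenvalues, every product contains a zero factor.
\<close>

lemma split_vector_expansion:
  assumes P: "eigenprojections d A E th" and A: "endo A"
  shows "split_vector A \<eta> u i = (\<Sum>k\<le>d. (\<Prod>j<i. th k - \<eta> j) *s E k u)"
proof (induction i)
  case 0
  then show ?case using P by (simp add: eigenprojections_def)
next
  case (Suc i)
  interpret A: Vector_Spaces.linear scale scale A by fact
  let ?c = "\<lambda>k. \<Prod>j<i. th k - \<eta> j"
  have "split_vector A \<eta> u (Suc i)
      = (\<Sum>k\<le>d. ?c k *s A (E k u)) - (\<Sum>k\<le>d. \<eta> i *s (?c k *s E k u))"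
    by (simp add: Suc A.sum A.scale scale_sum_right)
  also have "\<dots> = (\<Sum>k\<le>d. (?c k * (th k - \<eta> i)) *s E k u)"
    unfolding sum_subtractf[symmetric]
    using P by (intro sum.cong) (auto simp: eigenprojections_def algebra_simps)
  finally show ?case by simp
qed

text \<open>
In the basis of split vectors for the reversed ordering of the \<open>E i\<close>, the last diagonal entry of \<open>A\<close>
is \<open>th 0\<close> while that of \<open>As\<close> is \<open>ths d\<close> for the last index \<open>d\<close>. These differ in general, so the
corner identity is a genuine linear equation for \<open>ph d\<close>, the last entry of the second split sequence. The scalar \<open>f\<close>
cancels because the relation is homogeneous of degree two in it.
\<close>

lemma second_split_corner:
  assumes A: "endo A" and As: "endo As"
    and P: "eigenprojections (Suc n) A E th" and Ps: "eigenprojections (Suc n) As Es ths"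
    and th: "\<And>i. i \<le> Suc n \<Longrightarrow> eigenvalue_of A (E i) = th i"
    and ths: "\<And>i. i \<le> Suc n \<Longrightarrow> eigenvalue_of As (Es i) = ths i"
    and split: "first_split_sequence (Suc n) A (\<lambda>i. E (Suc n - i)) As Es ph"
    and W: "W = (\<lambda>v. f *s (\<Sum>i\<le>Suc n. \<tau> i *s E i v))"
    and Ws: "Ws = (\<lambda>v. f *s (\<Sum>i\<le>Suc n. \<tau> i *s Es i v))"
    and f: "f \<noteq> 0"
    and inter: "\<And>v. Ws (W (As v)) = A (Ws (W v))"
  shows "\<tau> 0 * \<tau> (Suc n) * (ths (Suc n) - th 0)
       = ph (Suc n) * (\<tau> 0 * ((\<tau> (Suc n) - \<tau> n) / (ths (Suc n) - ths n))
                       - \<tau> (Suc n) * ((\<tau> 0 - \<tau> 1) / (th 0 - th 1)))"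
proof -
  interpret A: Vector_Spaces.linear scale scale A by fact
  interpret As: Vector_Spaces.linear scale scale As by fact
  define d where "d = Suc n"
  note P = P[folded d_def] and Ps = Ps[folded d_def]
  obtain u where u: "u \<noteq> 0" "Es 0 u = u"
    using Ps by (auto simp: eigenprojections_def)
  then have ur: "u \<in> range (Es 0)" by (metis rangeI)
  define \<eta> where "\<eta> = (\<lambda>i. eigenvalue_of A (E (d - i)))"
  define w where "w = split_vector A \<eta> u"
  have \<eta>: "\<eta> i = th (d - i)" if "i \<le> d" for i
    using th that by (simp add: \<eta>_def d_def)
  have B: "ordered_basis d w"
    and As0: "As (w 0) = ths 0 *s w 0"
    and AsS: "\<And>i. i \<in> {1..d} \<Longrightarrow> As (w i) = ths i *s w i + ph i *s w (i - 1)"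
    using split ths u(1) ur
    unfolding first_split_sequence_def Let_def w_def \<eta>_def d_def by auto
  have Aw: "A (w i) = \<eta> i *s w i + w (Suc i)" for i
    by (simp add: w_def)
  have "w (Suc d) = (\<Sum>k\<le>d. (\<Prod>j<Suc d. th k - \<eta> j) *s E k u)"
    unfolding w_def by (rule split_vector_expansion[OF P A])
  also have "\<dots> = 0"
  proof (rule sum.neutral, rule ballI)
    fix k assume "k \<in> {..d}"
    then have "d - k \<in> {..<Suc d}" "th k - \<eta> (d - k) = 0" by (auto simp: \<eta>)
    then have "(\<Prod>j<Suc d. th k - \<eta> j) = 0" by (intro prod_zero) auto
    then show "(\<Prod>j<Suc d. th k - \<eta> j) *s E k u = 0" by simp
  qed
  finally have wSd: "w (Suc d) = 0" .
  define \<alpha> where "\<alpha> = (\<lambda>v. representation (w ` {..d}) v (w n))"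
  define \<beta> where "\<beta> = (\<lambda>v. representation (w ` {..d}) v (w d))"
  have lin: "Vector_Spaces.linear scale (*) \<alpha>" "Vector_Spaces.linear scale (*) \<beta>"
    unfolding \<alpha>_def \<beta>_def by (rule ordered_basis_coordinate(1)[OF B])+
  note al = functional_rules[OF lin(1)] and be = functional_rules[OF lin(2)]
  have dual: "\<alpha> (w i) = (if i = n then 1 else 0)" "\<beta> (w i) = (if i = d then 1 else 0)"
    if "i \<le> d" for i
    unfolding \<alpha>_def \<beta>_def
    using ordered_basis_coordinate(2)[OF B that, of n] ordered_basis_coordinate(2)[OF B that, of d]
    by (simp_all add: d_def)
  have E: "endo (E i)" "endo (Es i)" if "i \<le> d" for i
    using P Ps that by (auto simp: eigenprojections_def)
  have linW: "endo W" "endo Ws"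
    unfolding W Ws by (intro weighted_sum_linear; use E in \<open>simp add: d_def\<close>)+
  have \<beta>A: "\<beta> (A v) = th 0 * \<beta> v + \<alpha> v" for v
  proof (rule functional_eq_on_ordered_basis[OF B, of "\<lambda>v. \<beta> (A v)" "\<lambda>v. th 0 * \<beta> v + \<alpha> v"])
    show "Vector_Spaces.linear scale (*) (\<lambda>v. \<beta> (A v))"
      by (rule functional_compose[OF A lin(2)])
    show "Vector_Spaces.linear scale (*) (\<lambda>v. th 0 * \<beta> v + \<alpha> v)"
      using functional_combination[OF lin(2,1), of "th 0" 1] by simp
    fix i assume i: "i \<le> d"
    show "\<beta> (A (w i)) = th 0 * \<beta> (w i) + \<alpha> (w i)"
    proof (cases "i = d")
      case True
      then show ?thesis by (simp add: Aw wSd be \<eta> dual) (simp add: d_def)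
    next
      case False
      then show ?thesis using i by (simp add: Aw be dual) (simp add: d_def)
    qed
  qed
  have \<beta>As: "\<beta> (As v) = ths d * \<beta> v" for v
  proof (rule functional_eq_on_ordered_basis[OF B, of "\<lambda>v. \<beta> (As v)" "\<lambda>v. ths d * \<beta> v"])
    show "Vector_Spaces.linear scale (*) (\<lambda>v. \<beta> (As v))"
      by (rule functional_compose[OF As lin(2)])
    show "Vector_Spaces.linear scale (*) (\<lambda>v. ths d * \<beta> v)"
      using functional_combination[OF lin(2,2), of "ths d" 0] by simp
    fix i assume i: "i \<le> d"
    show "\<beta> (As (w i)) = ths d * \<beta> (w i)"
      using i AsS[of i] by (cases "i = 0") (auto simp: As0 be dual)
  qed
  have \<alpha>As: "\<alpha> (As v) = ths n * \<alpha> v + ph d * \<beta> v" for v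
  proof (rule functional_eq_on_ordered_basis[OF B, of "\<lambda>v. \<alpha> (As v)" "\<lambda>v. ths n * \<alpha> v + ph d * \<beta> v"])
    show "Vector_Spaces.linear scale (*) (\<lambda>v. \<alpha> (As v))"
      by (rule functional_compose[OF As lin(1)])
    show "Vector_Spaces.linear scale (*) (\<lambda>v. ths n * \<alpha> v + ph d * \<beta> v)"
      by (rule functional_combination[OF lin])
    fix i assume i: "i \<le> d"
    show "\<alpha> (As (w i)) = ths n * \<alpha> (w i) + ph d * \<beta> (w i)"
    proof (cases i)
      case 0
      then show ?thesis by (simp add: As0 al dual) (simp add: d_def)
    next
      case (Suc k)
      then show ?thesis using i AsS[of i] by (simp add: al dual) (simp add: d_def)
    qed
  qed
  have inj: "th 0 \<noteq> th 1" "ths d \<noteq> ths n"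
    using P Ps inj_onD[of th "{..d}" 0 1] inj_onD[of ths "{..d}" d n]
    by (auto simp: eigenprojections_def d_def)
  have "(f * \<tau> 0) * (f * \<tau> d) * (ths d - th 0)
      = ph d * ((f * \<tau> 0) * ((f * \<tau> d - f * \<tau> n) / (ths d - ths n))
                - (f * \<tau> d) * ((f * \<tau> 0 - f * \<tau> 1) / (th 0 - th 1)))"
  proof (rule corner_identity[where A = A and As = As and W = W and Ws = Ws
        and \<alpha> = \<alpha> and \<beta> = \<beta> and x = "w n" and y = "w d",
        OF A linW lin inter])
    show "W v = (f * \<tau> 0) *s v" if "A v = th 0 *s v" for v
      using weighted_sum_eigenvector[OF P _ that, of f \<tau>] unfolding W d_def by simp
    show "W v = (f * \<tau> 1) *s v" if "A v = th 1 *s v" for v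
      using weighted_sum_eigenvector[OF P _ that, of f \<tau>] unfolding W d_def by simp
    show "g (Ws v) = (f * \<tau> d) * g v"
      if "Vector_Spaces.linear scale (*) g" "\<And>v. g (As v) = ths d * g v" for g v
      using weighted_sum_eigenfunctional[where j = d and g = g, OF Ps _ that, of f \<tau> v]
      unfolding Ws d_def by simp
    show "g (Ws v) = (f * \<tau> n) * g v"
      if "Vector_Spaces.linear scale (*) g" "\<And>v. g (As v) = ths n * g v" for g v
      using weighted_sum_eigenfunctional[where j = n and g = g, OF Ps _ that, of f \<tau> v]
      unfolding Ws d_def by simp
    show "A (w n) = th 1 *s w n + w d" using Aw[of n] \<eta>[of n] by (simp add: d_def)
    show "A (w d) = th 0 *s w d" using Aw[of d] \<eta>[of d] wSd by simp
    show "As (w d) = ths d *s w d + ph d *s w n" using AsS[of d] by (simp add: d_def)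
  qed (use \<beta>A \<beta>As \<alpha>As inj dual in \<open>auto simp: d_def\<close>)
  also have "\<dots> = (f * f) * (ph d * (\<tau> 0 * ((\<tau> d - \<tau> n) / (ths d - ths n))
                - \<tau> d * ((\<tau> 0 - \<tau> 1) / (th 0 - th 1))))"
    by (simp add: divide_inverse algebra_simps)
  finally have "(f * f) * (\<tau> 0 * \<tau> d * (ths d - th 0)) = \<dots>"
    by (simp add: ac_simps)
  then show ?thesis using f unfolding d_def mult_cancel_left by simp
qed

end

section \<open>Solving the corner equation in the q-Racah case\<close>

text \<open>
With \<open>s = a P\<close>, \<open>t = P / a\<close> and \<open>k = q - 1 / q\<close>, the two divided differences simplify to
\<open>s / (k (s - 1))\<close> and \<open>t / (k (t - 1))\<close>. Their difference is \<open>- P (a - 1 / a) / (k (s - 1) (t - 1))\<close>, and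
the factor \<open>a - 1 / a\<close> also divides \<open>thd - th0\<close>. After cancellation the equation becomes
\<open>(s - 1) (t - 1) = 1 + P\<^sup>2 - P (c + 1 / c)\<close>, whose left-hand side has the same shape with \<open>a\<close> in place
of \<open>c\<close>. The factors cancelled up to this point divide differences of eigenvalues, so they are nonzero.
\<close>

lemma huang_parameter_of_corner:
  fixes a c q P :: "'f::field"
  assumes nz: "a \<noteq> 0" "c \<noteq> 0" "q \<noteq> 0" "P \<noteq> 0"
    and d0: "th0 = a / (q * P) + q * P / a"
    and d1: "th1 = a * q / P + P / (a * q)"
    and d2: "thm = a * P / q + q / (a * P)"
    and d3: "thd = a * q * P + 1 / (a * q * P)"
    and ne: "th0 \<noteq> th1" "thd \<noteq> thm" "thd \<noteq> th0"
    and phi: "phi = q\<^sup>2 * P * (q * P - 1 / (q * P)) * (1 / q - q)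
               * (1 / (q * P) - c / q) * (1 / (q * P) - 1 / (c * q))"
    and eq: "thd - th0 = phi * ((1 + a * P) / (thd - thm) - (1 + P / a) / (th0 - th1))"
  shows "c = a \<or> c = inverse a"
proof -
  define k where "k = q - 1 / q"
  define s where "s = a * P"
  define t where "t = P / a"
  define e where "e = a - 1 / a"
  define m where "m = q * P - 1 / (q * P)"
  have snz: "s \<noteq> 0" "t \<noteq> 0" using nz by (auto simp: s_def t_def)
  have inv: "a * inverse a = 1" "c * inverse c = 1" "q * inverse q = 1" "P * inverse P = 1"
    using nz by simp_all
  note di = divide_inverse inverse_mult_distrib inverse_inverse_eq mult_1
  have f1: "thd - thm = k * (s + 1) * (s - 1) / s"
    unfolding d2 d3 k_def s_def di using inv by algebra
  have f2: "th0 - th1 = k * (t + 1) * (t - 1) / t"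
    unfolding d0 d1 k_def t_def di using inv by algebra
  have f3: "thd - th0 = m * e"
    unfolding d0 d3 m_def e_def di by (simp add: algebra_simps)
  have z: "k \<noteq> 0" "s + 1 \<noteq> 0" "s - 1 \<noteq> 0" "t + 1 \<noteq> 0" "t - 1 \<noteq> 0" "m \<noteq> 0" "e \<noteq> 0"
    using f1 f2 f3 ne by auto
  have "(1 + a * P) / (thd - thm) = s / (k * (s - 1))"
    unfolding f1 s_def[symmetric] using z snz by (simp add: divide_simps)
  moreover have "(1 + P / a) / (th0 - th1) = t / (k * (t - 1))"
    unfolding f2 t_def[symmetric] using z snz by (simp add: divide_simps)
  moreover have "s / (k * (s - 1)) - t / (k * (t - 1)) = (t - s) / (k * (s - 1) * (t - 1))"
    using z(1,3,5) by (simp add: divide_simps) (simp add: algebra_simps)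
  moreover have "t - s = - P * e"
    unfolding s_def t_def e_def using nz by (simp add: field_simps)
  ultimately have "m * e = phi * (- P * e / (k * (s - 1) * (t - 1)))"
    using eq f3 by simp
  then have "e * (m * k * (s - 1) * (t - 1)) = e * (- (phi * P))"
    using z(1,3,5) by (simp add: divide_simps) (simp add: algebra_simps)
  then have "m * k * (s - 1) * (t - 1) = - (phi * P)"
    using z(7) by (simp only: mult_cancel_left simp_thms)
  moreover have "phi * P = - (m * k * (1 + P * P - P * (c + 1 / c)))"
    unfolding phi m_def k_def di using inv by algebra
  ultimately have "m * k * ((s - 1) * (t - 1)) = m * k * (1 + P * P - P * (c + 1 / c))"
    by (simp add: mult.assoc)
  then have "(s - 1) * (t - 1) = 1 + P * P - P * (c + 1 / c)"
    using z by simp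
  moreover have "(s - 1) * (t - 1) = 1 + P * P - P * (a + 1 / a)"
    unfolding s_def t_def di using inv by algebra
  ultimately have "a + 1 / a = c + 1 / c"
    using nz by simp
  then have "(c - a) * (c - inverse a) = 0"
    unfolding di using inv by algebra
  then show ?thesis by simp
qed

section \<open>The third Huang parameter of a Boltzmann pair\<close>

theorem lemma6p18:
  fixes scale :: "'f::field \<Rightarrow> 'v::ab_group_add \<Rightarrow> 'v"
    and q a b c f :: 'f and d :: nat
    and A As W Ws :: "'v \<Rightarrow> 'v" and E Es :: "nat \<Rightarrow> 'v \<Rightarrow> 'v"
    and \<tau> :: "nat \<Rightarrow> 'f"
  assumes "vector_space scale"
    and "q \<noteq> 0" and "q ^ 4 \<noteq> 1"
    and "d \<ge> 1" and "vector_space.dim scale (UNIV :: 'v set) = d + 1"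
    and "vector_space.leonard_system scale d A E As Es"
    and "vector_space.q_racah_type scale q d A E As Es"
    and "vector_space.huang_data scale q d A E As Es a b c"
    and "b = a"
    and "\<And>i. i \<le> d \<Longrightarrow> \<tau> i = (-1) ^ i * a powi (- int i) * q ^ (i * (d - i))"
    and "f \<noteq> 0"
    and "W = (\<lambda>v. scale f (\<Sum>i\<le>d. scale (\<tau> i) (E i v)))"
    and "Ws = (\<lambda>v. scale f (\<Sum>i\<le>d. scale (\<tau> i) (Es i v)))"
    and "vector_space.boltzmann_pair scale A As W Ws"
  shows "c \<in> {a, inverse a}"
proof -
  interpret vector_space scale by fact
  obtain n where d: "d = Suc n" using assms(4) by (cases d) auto
  have LS: "leonard_pair A As" "standard_ordering d A As E" "standard_ordering d As A Es"
    using assms(6) by (simp_all add: leonard_system_def)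
  then have A: "endo A" and As: "endo As" by (simp_all add: leonard_pair_def)
  obtain m x m' x' where
    x: "ordered_basis m x" "diagonal m (matrix_wrt m x A)" and
    x': "ordered_basis m' x'" "diagonal m' (matrix_wrt m' x' As)"
    using LS(1) unfolding leonard_pair_def by blast
  define th where "th = (\<lambda>i. eigenvalue_of A (E i))"
  define ths where "ths = (\<lambda>i. eigenvalue_of As (Es i))"
  have prE: "eigenprojections d A E th"
    unfolding th_def using LS(2) assms(5) A x
    by (intro eigenprojections_of_standard_ordering) (auto simp: standard_ordering_def)
  have prEs: "eigenprojections d As Es ths"
    unfolding ths_def using LS(3) assms(5) As x'
    by (intro eigenprojections_of_standard_ordering) (auto simp: standard_ordering_def)
  define ph where "ph = (\<lambda>i.
       a * inverse b * q ^ (d + 1)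
       * (q powi int i - q powi (- int i))
       * (q powi (int i - int d - 1) - q powi (int d - int i + 1))
       * (q powi (- int i) - inverse a * b * c * q powi (int i - int d - 1))
       * (q powi (- int i) - inverse a * b * inverse c * q powi (int i - int d - 1)))"
  have nz: "a \<noteq> 0" "c \<noteq> 0" "q \<noteq> 0"
    and ev: "\<And>i. i \<le> d \<Longrightarrow> th i = a * q powi (2 * int i - int d) + inverse a * q powi (int d - 2 * int i)"
      "\<And>i. i \<le> d \<Longrightarrow> ths i = a * q powi (2 * int i - int d) + inverse a * q powi (int d - 2 * int i)"
    and split: "first_split_sequence d A (\<lambda>i. E (d - i)) As Es ph"
    using assms(2,8,9)
    unfolding huang_data_def q_racah_eigenvalues_def second_split_sequence_def th_def ths_def ph_def
    by auto
  have inter: "Ws (W (As v)) = A (Ws (W v))" for v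
  proof -
    have bp: "bij W" "bij Ws" "W \<circ> As \<circ> inv W = inv Ws \<circ> A \<circ> Ws"
      using assms(14) by (simp_all add: boltzmann_pair_def)
    from bp(3) have "W (As (inv W (W v))) = inv Ws (A (Ws (W v)))"
      by (simp add: fun_eq_iff)
    then show ?thesis
      using bp(1,2) by (simp add: bij_is_inj bij_is_surj surj_f_inv_f)
  qed
  have th_eq: "th i = ths i" if "i \<le> d" for i using ev that by simp
  have entry: "\<tau> 0 * \<tau> d * (th d - th 0)
       = ph d * (\<tau> 0 * ((\<tau> d - \<tau> n) / (th d - th n)) - \<tau> d * ((\<tau> 0 - \<tau> 1) / (th 0 - th 1)))"
  proof -
    have "eigenvalue_of A (E i) = th i" "eigenvalue_of As (Es i) = ths i" for i
      by (simp_all add: th_def ths_def)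
    from second_split_corner[where A = A and As = As and E = E and Es = Es and W = W and Ws = Ws
        and th = th and ths = ths and ph = ph and f = f and \<tau> = \<tau> and n = n,
        OF A As prE[unfolded d] prEs[unfolded d] this split[unfolded d]
        assms(12)[unfolded d] assms(13)[unfolded d] assms(11) inter]
    show ?thesis by (simp add: th_eq d)
  qed
  \<comment> \<open>In terms of \<open>P\<close> and \<open>T\<close> all quantities in the equation are rational expressions.\<close>
  define P where "P = q ^ n"
  define T where "T = \<tau> d"
  have P0: "P \<noteq> 0" using nz by (simp add: P_def)
  have pw: "q powi (int n + 1) = q * P" "q powi (- int n - 1) = 1 / (q * P)"
    "q powi (1 - int n) = q / P" "q powi (int n - 1) = P / q"
    using nz by (simp_all add: P_def power_int_add power_int_diff power_int_minus divide_inverse)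
  have th0: "th 0 = a / (q * P) + q * P / a"
  proof -
    have "2 * int 0 - int d = - int n - 1" "int d - 2 * int 0 = int n + 1"
      by (simp_all add: d)
    from ev(1)[of 0, unfolded this pw] show ?thesis
      by (simp add: d divide_inverse mult_ac)
  qed
  have th1: "th 1 = a * q / P + P / (a * q)"
  proof -
    have "2 * int 1 - int d = 1 - int n" "int d - 2 * int 1 = int n - 1"
      by (simp_all add: d)
    from ev(1)[of 1, unfolded this pw] show ?thesis
      by (simp add: d divide_inverse mult_ac)
  qed
  have thn: "th n = a * P / q + q / (a * P)"
  proof -
    have "2 * int n - int d = int n - 1" "int d - 2 * int n = 1 - int n"
      by (simp_all add: d)
    from ev(1)[of n, unfolded this pw] show ?thesis
      by (simp add: d divide_inverse mult_ac)
  qed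
  have thd: "th d = a * q * P + 1 / (a * q * P)"
  proof -
    have "2 * int d - int d = int n + 1" "int d - 2 * int d = - int n - 1"
      by (simp_all add: d)
    from ev(1)[of d, unfolded this pw] show ?thesis
      by (simp add: d divide_inverse mult_ac)
  qed
  have dd: "int d = int n + 1" "- int d = - int n - 1" by (simp_all add: d)
  have pwd: "q powi int d = q * P" "q powi (- int d) = 1 / (q * P)"
    using pw(1,2) unfolding dd(1)[symmetric] dd(2)[symmetric] .
  have pw1: "q powi (int d - int d - 1) = 1 / q" "q powi (int d - int d + 1) = q"
      "q ^ (d + 1) = q\<^sup>2 * P"
    by (simp_all add: d P_def power_int_minus divide_inverse power2_eq_square)
  have phi: "ph d = q\<^sup>2 * P * (q * P - 1 / (q * P)) * (1 / q - q)
               * (1 / (q * P) - c / q) * (1 / (q * P) - 1 / (c * q))"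
    using nz \<open>b = a\<close> unfolding ph_def pwd pw1 by (simp add: divide_inverse)
  have T_eq: "T = (-1) ^ d * a powi (- int d)"
    using assms(10)[of d] by (simp add: T_def)
  then have T0: "T \<noteq> 0" using nz by simp
  have \<tau>: "\<tau> 0 = 1" "\<tau> 1 = - (P / a)"
    using assms(10)[of 0] assms(10)[of 1] by (simp_all add: d P_def divide_inverse power_int_minus)
  have \<tau>n: "\<tau> n = - (a * P * T)"
  proof -
    have "a powi (- int d) = inverse a * a powi (- int n)"
      unfolding power_int_minus power_int_of_nat by (simp add: d)
    then show ?thesis
      using assms(10)[of n] nz unfolding T_eq by (simp add: d P_def)
  qed
  have inj: "inj_on th {..d}" using prE by (simp add: eigenprojections_def)
  have ne: "th 0 \<noteq> th 1" "th d \<noteq> th n" "th d \<noteq> th 0"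
    using inj_onD[OF inj, of 0 1] inj_onD[OF inj, of d n] inj_onD[OF inj, of d 0]
    by (auto simp: d)
  have "T * (th d - th 0)
      = T * (ph d * ((1 + a * P) / (th d - th n) - (1 + P / a) / (th 0 - th 1)))"
    using entry unfolding \<tau> \<tau>n T_def[symmetric] by (simp add: divide_inverse algebra_simps)
  then have "th d - th 0 = ph d * ((1 + a * P) / (th d - th n) - (1 + P / a) / (th 0 - th 1))"
    using T0 by simp
  from huang_parameter_of_corner[OF nz(1,2,3) P0 th0 th1 thn thd ne phi this]
  show ?thesis by simp
qed

end
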